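(* Let $L$ be a skew basic $(p,q)$-leaper with $p<q$, and let $\frac qp=[c_1\pm,c_2\pm,\ldots,c_k]$ be the representation of $\frac qp$ as an even continued fraction. For all $i=1,\ldots,k$ let \[\frac{l_i}{d_i}=[c_1\pm,2-,c_2\pm,2-,\ldots,c_i],\] where $\frac{l_i}{d_i}$ is irreducible, the sign following each $c_j$ ($j<i$) is the same as in the representation of $\frac qp$, and the sign following each inserted term $2$ is $-$. Then the length of each cycle of type $i$ of $L$ within a $(p+q)\times(p+q)$ chessboard is $4l_i$.
   Context: Leapers. A square is a unit square of the infinite chessboard. A $(p,q)$-leaper is a piece that moves from a square $a$ to any of $a+(\pm p,\pm q)$, $a+(\pm q,\pm p)$. The leaper graph of $L$ over a set of squares $B$ has the squares of $B$ as vertices, two being adjacent when a move of $L$ joins them; a cycle of $L$ within $B$ is a simple cycle in this graph, and its length is its number of squares. The leaper is basic if $p+q$ is odd and $\gcd(p,q)=1$, and skew if $p,q$ are nonzero and distinct. Even continued fractions. $[c_1\pm,c_2\pm,\ldots,c_k]=c_1\pm\cfrac1{c_2\pm\cfrac1{\ddots\pm\frac1{c_k}}}$, where each sign is chosen independently, all $c_i$ are even integers, $c_1\ge0$ and $c_2,\ldots,c_k>0$. A nonnegative irreducible fraction $\frac qp$ with $p+q$ odd has exactly one such representation. Frames. Let $m<n$ be coprime positive integers with $m+n$ odd. Identify squares with their centers, the centers being the points of $\mathbb Z^2$. The $(m,n)$-frame $F$ is the set of squares $(x,y)$ with $\frac{n-m}2<\max(|x|,|y|)<\frac{m+n}2$,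 i.e. an $(m+n)\times(m+n)$ board with an $(n-m)\times(n-m)$ central hole. Its section $F_{\mathtt E}$ consists of the squares with $\frac{n-m}2<x<\frac{m+n}2$, $|y|<\frac{n-m}2$; its section $F_{\mathtt{NE}}$ of those with $\frac{n-m}2<x,y<\frac{m+n}2$; the sections $F_{\mathtt N},F_{\mathtt{NW}},F_{\mathtt W},F_{\mathtt{SW}},F_{\mathtt S},F_{\mathtt{SE}}$ are obtained by counterclockwise rotations by multiples of $90^\circ$ about the origin. In the leaper graph of the $(m,n)$-leaper over the $(m+n)\times(m+n)$ board the squares of the hole are isolated and all squares of $F$ have degree two, so a cycle is determined by its vertex set. Lifting. The lifting transformations $\mathtt f,\mathtt g,\mathtt h$ take $S\subseteq F$ to the disjoint union of $(S+v_i)\cap H_i$ over the eight directions $i$, where $H$ is respectively the $(m,2m+n)$-, $(n,2n-m)$-, $(n,m+2n)$-frame, and for $\mathtt f$: $v_{\mathtt E}=(m+n,0)$, $v_{\mathtt{NE}}=(m,m)$; for $\mathtt g$: $v_{\mathtt E}=(n-m,0)$, $v_{\mathtt{NE}}=(n,n)$; for $\mathtt h$: $v_{\mathtt E}=(m+n,0)$, $v_{\mathtt{NE}}=(n,n)$; the other $v_i$ are obtained by $90^\circ$ rotations. Each maps the vertex set of a cycle of the $(m,n)$-leaper within $F$ to the vertex set of a cycle of the leaper with the proportions of $H$ within $H$; this defines the lift of a cycle. Shell. Let $n\le3m$. If $2m\ge n$, the shell of $F$ is the union of eight $(n-m)\times(n-m)$ subboards: the four corners of $F$ and the four adjacent by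 side to the central hole. If $2m\le n\le3m$, it is the union of eight $(3m-n)\times(3m-n)$ subboards: one in the middle of each outer side and four adjacent by corner to the central hole. (When $n=2m$ both give all of $F$.) The shell is a union of eight-square cycles of the $(m,n)$-leaper, called shell cycles. Types. Let $p<q$ and $\frac qp=[c_1\pm,\ldots,c_k]$, and set $x_i=\mathtt g$ if the sign following $c_i$ is $-$ and $x_i=\mathtt h$ if it is $+$ ($1\le i<k$). Let $\mathtt f^{a}$ denote a run of $a$ characters $\mathtt f$, and $e^{(i)}=\mathtt f^{c_1/2-1}x_1\mathtt f^{c_2/2-1}x_2\cdots x_{i-1}\mathtt f^{c_i/2-1}$. For $i<k$ let $F^{(i)}$ be the frame whose (coprime) proportions $(m,n)$ satisfy $\frac nm=[2\pm,c_{i+1}\pm,\ldots,c_k]$, the sign after $2$ being the one following $c_i$ and the other signs being as in $\frac qp$; let $F^{(k)}$ be the $(1,2)$-frame. A cycle of $L$ within the $(p+q)\times(p+q)$ board is of type $i$ if it is obtained from a shell cycle of $F^{(i)}$ by successively applying the lifting transformations given by the characters of $e^{(i)}$, from the last character to the first. Every cycle of $L$ within the $(p+q)\times(p+q)$ board is of exactly one type. *)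

theory Defs
  imports Complex_Main "HOL-Library.Product_Plus"
begin

type_synonym square = "int \<times> int"

definition leaper_moves :: "int \<Rightarrow> int \<Rightarrow> square set" where
  "leaper_moves p q =
     {(p, q), (p, -q), (-p, q), (-p, -q), (q, p), (q, -p), (-q, p), (-q, -p)}"

definition leaper_adj :: "int \<Rightarrow> int \<Rightarrow> square \<Rightarrow> square \<Rightarrow> bool" where
  "leaper_adj p q a b \<longleftrightarrow> b - a \<in> leaper_moves p q"

text \<open>A simple cycle of the leaper graph over \<open>B\<close>, listed from some starting square in one of
  its two directions.  Its length as a cycle is the length of the list.\<close>

definition leaper_cycle :: "int \<Rightarrow> int \<Rightarrow> square set \<Rightarrow> square list \<Rightarrow> bool" where
  "leaper_cycle p q B vs \<longleftrightarrow>
     3 \<le> length vs \<and> distinct vs \<and> set vs \<subseteq> B \<and>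
     (\<forall>j < length vs. leaper_adj p q (vs ! j) (vs ! (Suc j mod length vs)))"

definition basic_leaper :: "int \<Rightarrow> int \<Rightarrow> bool" where
  "basic_leaper p q \<longleftrightarrow> odd (p + q) \<and> gcd p q = 1"

definition skew_leaper :: "int \<Rightarrow> int \<Rightarrow> bool" where
  "skew_leaper p q \<longleftrightarrow> p \<noteq> 0 \<and> q \<noteq> 0 \<and> p \<noteq> q"

datatype sign = PlusSign | MinusSign

fun sign_val :: "sign \<Rightarrow> rat" where
  "sign_val PlusSign = 1"
| "sign_val MinusSign = -1"

text \<open>The terms \<open>c\<^sub>1, \<dots>, c\<^sub>k\<close> and the signs following \<open>c\<^sub>1, \<dots>, c\<^sub>k\<^sub>-\<^sub>1\<close> are kept in two separate
  lists.  The values for lists of unsuitable lengths are irrelevant.\<close>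

fun cf_val :: "int list \<Rightarrow> sign list \<Rightarrow> rat" where
  "cf_val (c # cs) (s # ss) = of_int c + sign_val s / cf_val cs ss"
| "cf_val (c # cs) [] = of_int c"
| "cf_val [] ss = 0"

definition even_cf :: "int list \<Rightarrow> sign list \<Rightarrow> bool" where
  "even_cf cs ss \<longleftrightarrow>
     cs \<noteq> [] \<and> length cs = length ss + 1 \<and>
     (\<forall>c \<in> set cs. even c) \<and> 0 \<le> hd cs \<and> (\<forall>c \<in> set (tl cs). 0 < c)"

text \<open>Boards and frames are centered at the origin.  All bounds on coordinates below are
  half-integers, so the inequalities are multiplied by two.\<close>

definition board :: "int \<Rightarrow> square set" where
  "board s = {(x, y). 2 * max \<bar>x\<bar> \<bar>y\<bar> < s}"

definition frame :: "int \<Rightarrow> int \<Rightarrow> square set" where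
  "frame m n = {(x, y). n - m < 2 * max \<bar>x\<bar> \<bar>y\<bar> \<and> 2 * max \<bar>x\<bar> \<bar>y\<bar> < m + n}"

text \<open>Counterclockwise rotation by a quarter turn; the eight directions are
  \<open>(rot ^^ j) E\<close> and \<open>(rot ^^ j) NE\<close> for \<open>j < 4\<close>.\<close>

fun rot :: "square \<Rightarrow> square" where
  "rot (x, y) = (- y, x)"

definition section_E :: "int \<Rightarrow> int \<Rightarrow> square set" where
  "section_E m n = {(x, y). n - m < 2 * x \<and> 2 * x < m + n \<and> 2 * \<bar>y\<bar> < n - m}"

definition section_NE :: "int \<Rightarrow> int \<Rightarrow> square set" where
  "section_NE m n = {(x, y). n - m < 2 * x \<and> 2 * x < m + n \<and> n - m < 2 * y \<and> 2 * y < m + n}"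

datatype lifting = Lift_f | Lift_g | Lift_h

fun lift_prop :: "lifting \<Rightarrow> int \<times> int \<Rightarrow> int \<times> int" where
  "lift_prop Lift_f (m, n) = (m, 2 * m + n)"
| "lift_prop Lift_g (m, n) = (n, 2 * n - m)"
| "lift_prop Lift_h (m, n) = (n, m + 2 * n)"

fun shift_E :: "lifting \<Rightarrow> int \<times> int \<Rightarrow> square" where
  "shift_E Lift_f (m, n) = (m + n, 0)"
| "shift_E Lift_g (m, n) = (n - m, 0)"
| "shift_E Lift_h (m, n) = (m + n, 0)"

fun shift_NE :: "lifting \<Rightarrow> int \<times> int \<Rightarrow> square" where
  "shift_NE Lift_f (m, n) = (m, m)"
| "shift_NE Lift_g (m, n) = (n, n)"
| "shift_NE Lift_h (m, n) = (n, n)"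

definition lift_set :: "lifting \<Rightarrow> int \<times> int \<Rightarrow> square set \<Rightarrow> square set" where
  "lift_set t mn S =
     (let (m', n') = lift_prop t mn in
      (\<Union>j<4. (\<lambda>a. a + (rot ^^ j) (shift_E t mn)) ` S \<inter> (rot ^^ j) ` section_E m' n') \<union>
      (\<Union>j<4. (\<lambda>a. a + (rot ^^ j) (shift_NE t mn)) ` S \<inter> (rot ^^ j) ` section_NE m' n'))"

text \<open>Lift from the last character of the word to the first, keeping track of the proportions
  of the current frame.\<close>

definition lift_word :: "lifting list \<Rightarrow> (int \<times> int) \<times> square set \<Rightarrow> (int \<times> int) \<times> square set" where
  "lift_word w = foldr (\<lambda>t (mn, S). (lift_prop t mn, lift_set t mn S)) w"

text \<open>Meaningful for \<open>n \<le> 3 * m\<close>.  Let \<open>s\<close> be the side of the subboards.  In the first case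
  the two sets are the subboard adjacent by side to the hole on the east, and the
  north-east corner subboard; in the second case they are the middle subboard of the east outer
  side, and the subboard adjacent by corner to the hole on the north-east.\<close>

definition shell :: "int \<Rightarrow> int \<Rightarrow> square set" where
  "shell m n =
     (if n \<le> 2 * m then
        (let s = n - m in
         \<Union>j<4. (rot ^^ j) ` {(x, y). n - m < 2 * x \<and> 2 * x < n - m + 2 * s \<and> 2 * \<bar>y\<bar> < s} \<union>
               (rot ^^ j) ` {(x, y). m + n - 2 * s < 2 * x \<and> 2 * x < m + n \<and>
                                     m + n - 2 * s < 2 * y \<and> 2 * y < m + n})
      else
        (let s = 3 * m - n in
         \<Union>j<4. (rot ^^ j) ` {(x, y). m + n - 2 * s < 2 * x \<and> 2 * x < m + n \<and> 2 * \<bar>y\<bar> < s} \<union>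
               (rot ^^ j) ` {(x, y). n - m < 2 * x \<and> 2 * x < n - m + 2 * s \<and>
                                     n - m < 2 * y \<and> 2 * y < n - m + 2 * s}))"

text \<open>A shell cycle, as a set of squares.  Having eight squares is a consequence and is not
  built into the definition.\<close>

definition shell_cycle :: "int \<Rightarrow> int \<Rightarrow> square set \<Rightarrow> bool" where
  "shell_cycle m n C \<longleftrightarrow> (\<exists>vs. leaper_cycle m n (frame m n) vs \<and> set vs = C \<and> C \<subseteq> shell m n)"

text \<open>The index \<open>i\<close> of a type is counted from 1, but list positions are counted from 0: \<open>c\<^sub>i\<close> is
  \<open>cs ! (i - 1)\<close> and the sign following it is \<open>ss ! (i - 1)\<close>.\<close>

fun sign_lifting :: "sign \<Rightarrow> lifting" where
  "sign_lifting MinusSign = Lift_g"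
| "sign_lifting PlusSign = Lift_h"

definition f_run :: "int \<Rightarrow> lifting list" where
  "f_run c = replicate (nat (c div 2 - 1)) Lift_f"

definition type_word :: "int list \<Rightarrow> sign list \<Rightarrow> nat \<Rightarrow> lifting list" where
  "type_word cs ss i =
     concat (map (\<lambda>j. f_run (cs ! j) @ [sign_lifting (ss ! j)]) [0..<i - 1]) @ f_run (cs ! (i - 1))"

definition type_frame :: "int list \<Rightarrow> sign list \<Rightarrow> nat \<Rightarrow> int \<Rightarrow> int \<Rightarrow> bool" where
  "type_frame cs ss i m n \<longleftrightarrow>
     (if i < length cs
      then 0 < m \<and> coprime m n \<and>
           of_int n / of_int m = cf_val (2 # drop i cs) (drop (i - 1) ss)
      else m = 1 \<and> n = 2)"

text \<open>Here \<open>cs\<close>, \<open>ss\<close> is the even continued fraction of \<open>q / p\<close>.\<close>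

definition cycle_of_type ::
    "int \<Rightarrow> int \<Rightarrow> int list \<Rightarrow> sign list \<Rightarrow> nat \<Rightarrow> square list \<Rightarrow> bool" where
  "cycle_of_type p q cs ss i vs \<longleftrightarrow>
     leaper_cycle p q (board (p + q)) vs \<and>
     (\<exists>m n C. type_frame cs ss i m n \<and> shell_cycle m n C \<and>
        set vs = snd (lift_word (type_word cs ss i) ((m, n), C)))"

text \<open>The terms and signs of \<open>[c\<^sub>1\<plusminus>, 2-, c\<^sub>2\<plusminus>, 2-, \<dots>, c\<^sub>i]\<close>.\<close>

definition inserted_terms :: "int list \<Rightarrow> nat \<Rightarrow> int list" where
  "inserted_terms cs i = concat (map (\<lambda>j. [cs ! j, 2]) [0..<i - 1]) @ [cs ! (i - 1)]"

definition inserted_signs :: "sign list \<Rightarrow> nat \<Rightarrow> sign list" where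
  "inserted_signs ss i = concat (map (\<lambda>j. [ss ! j, MinusSign]) [0..<i - 1])"

end

theory Submission
  imports Defs
begin

text \<open>
  All that matters about a set of squares in a frame is how many of its squares lie in the four
  side sections (a rotation of E) and how many in the four corner sections (a rotation of NE).
  Each part \<open>(S + v\<^sub>i) \<inter> H\<^sub>i\<close> of a lift is a translated copy of the union of a few whole sections
  of \<open>S\<close>, so a lift acts linearly on the pair \<open>(a, b)\<close> of these two counts: \<open>f\<close> gives
  \<open>(a + 2b, b)\<close>, \<open>g\<close> gives \<open>(a, 2a + b)\<close> and \<open>h\<close> gives \<open>(3a + 2b, 2a + b)\<close>
  (\<open>section_counts_lift\<close>).

  The eight subboards of the shell are translates of one square board, centered at the rotations
  of \<open>(n - m, 0)\<close> and \<open>(m, m)\<close>.  A leaper move within the board leads from one of them to the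
  square with the same offset from the center in another one, and the eight subboards form a
  cycle in this way.  Hence a shell cycle has one square in each subboard, and its counts are
  \<open>(4, 4)\<close> (\<open>shell_cycle_section_counts\<close>).

  Finally, if a suffix of the continued fraction with inserted terms has the irreducible value
  \<open>l / d\<close>, then the corresponding suffix of the word turns \<open>(4, 4)\<close> into \<open>(4 (l - d), 4 d)\<close>.  This
  holds for a single term, and prepending \<open>c \<plusminus> 1 / (2 - 1 / (l / d))\<close> to the fraction changes
  \<open>l\<close> and \<open>d\<close> exactly as the corresponding lifts change the counts (\<open>lift_counts_type_word\<close>).
  The length of the cycle is the sum \<open>4 l\<close> of the two counts.
\<close>

section \<open>Rotations and sections\<close>

lemma rot_add: "rot (a + b) = rot a + rot b"
  by (cases a; cases b) auto

lemma rot_pow_add: "(rot ^^ j) (a + b) = (rot ^^ j) a + (rot ^^ j) b"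
  by (induction j) (auto simp: rot_add)

lemma inj_rot_pow: "inj (rot ^^ j)"
proof -
  have "inj rot" by (auto simp: inj_def)
  then show ?thesis by (induction j) (auto intro: inj_compose)
qed

lemma rot_pow_4: "rot ^^ (j + 4) = rot ^^ j"
proof -
  have "rot ^^ 4 = id" by (auto simp: fun_eq_iff numeral_eq_Suc)
  then show ?thesis by (simp add: funpow_add)
qed

lemma mem_rot_image: "(x, y) \<in> rot ` A \<longleftrightarrow> (y, - x) \<in> A"
  by force

lemma rot_pow_image_Suc: "(rot ^^ Suc j) ` A = rot ` (rot ^^ j) ` A"
  by (auto simp: image_comp)

text \<open>The side sections \<open>E, N, W, S\<close> and the corner sections \<open>NE, NW, SW, SE\<close> are numbered
  counterclockwise; the index is understood modulo 4.\<close>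

definition side_section :: "int \<Rightarrow> int \<Rightarrow> nat \<Rightarrow> square set" where
  "side_section m n j = (rot ^^ j) ` section_E m n"

definition corner_section :: "int \<Rightarrow> int \<Rightarrow> nat \<Rightarrow> square set" where
  "corner_section m n j = (rot ^^ j) ` section_NE m n"

text \<open>All squares of the eight sections.  For \<open>0 < m < n\<close> this is the whole frame when \<open>m + n\<close> is odd, but the
  parity is not needed when one works with this set instead of the frame.\<close>

definition sections :: "int \<Rightarrow> int \<Rightarrow> square set" where
  "sections m n = (\<Union>j<4. side_section m n j) \<union> (\<Union>j<4. corner_section m n j)"

text \<open>The total numbers of squares of \<open>S\<close> in the four side sections and in the four corner
  sections.\<close>

definition side_count :: "int \<Rightarrow> int \<Rightarrow> square set \<Rightarrow> nat" where
  "side_count m n S = (\<Sum>j<4. card (S \<inter> side_section m n j))"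

definition corner_count :: "int \<Rightarrow> int \<Rightarrow> square set \<Rightarrow> nat" where
  "corner_count m n S = (\<Sum>j<4. card (S \<inter> corner_section m n j))"

lemma lessThan_4: "{..<4::nat} = {0, 1, 2, 3}"
  by auto

lemma mem_side_section:
  "(x, y) \<in> side_section m n 0 \<longleftrightarrow>
     n - m < 2 * x \<and> 2 * x < m + n \<and> m - n < 2 * y \<and> 2 * y < n - m"
  "(x, y) \<in> side_section m n (Suc 0) \<longleftrightarrow>
     n - m < 2 * y \<and> 2 * y < m + n \<and> m - n < 2 * x \<and> 2 * x < n - m"
  "(x, y) \<in> side_section m n 2 \<longleftrightarrow>
     n - m < - 2 * x \<and> - 2 * x < m + n \<and> m - n < 2 * y \<and> 2 * y < n - m"
  "(x, y) \<in> side_section m n 3 \<longleftrightarrow>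
     n - m < - 2 * y \<and> - 2 * y < m + n \<and> m - n < 2 * x \<and> 2 * x < n - m"
  by (auto simp: side_section_def rot_pow_image_Suc mem_rot_image section_E_def
      numeral_eq_Suc simp del: funpow.simps)

lemma mem_corner_section:
  "(x, y) \<in> corner_section m n 0 \<longleftrightarrow>
     n - m < 2 * x \<and> 2 * x < m + n \<and> n - m < 2 * y \<and> 2 * y < m + n"
  "(x, y) \<in> corner_section m n (Suc 0) \<longleftrightarrow>
     n - m < - 2 * x \<and> - 2 * x < m + n \<and> n - m < 2 * y \<and> 2 * y < m + n"
  "(x, y) \<in> corner_section m n 2 \<longleftrightarrow>
     n - m < - 2 * x \<and> - 2 * x < m + n \<and> n - m < - 2 * y \<and> - 2 * y < m + n"
  "(x, y) \<in> corner_section m n 3 \<longleftrightarrow>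
     n - m < 2 * x \<and> 2 * x < m + n \<and> n - m < - 2 * y \<and> - 2 * y < m + n"
  by (auto simp add: corner_section_def rot_pow_image_Suc mem_rot_image section_NE_def
      numeral_eq_Suc simp del: funpow.simps)

lemma section_add_4:
  "side_section m n (j + 4) = side_section m n j"
  "corner_section m n (j + 4) = corner_section m n j"
  by (simp_all add: side_section_def corner_section_def rot_pow_4)

lemma rot_pow_section:
  "(rot ^^ j) ` side_section m n i = side_section m n (j + i)"
  "(rot ^^ j) ` corner_section m n i = corner_section m n (j + i)"
  by (simp_all add: side_section_def corner_section_def funpow_add image_comp)

lemma sections_eq:
  "sections m n = side_section m n 0 \<union> side_section m n (Suc 0) \<union>
     side_section m n 2 \<union> side_section m n 3 \<union>
     corner_section m n 0 \<union> corner_section m n (Suc 0) \<union>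
     corner_section m n 2 \<union> corner_section m n 3"
  by (auto simp: sections_def lessThan_4)

lemma rot_pow_sections: "(rot ^^ j) ` sections m n = sections m n"
proof (induction j)
  case (Suc j)
  have "rot ` sections m n = sections m n"
    using rot_pow_section[of 1 m n] section_add_4[of m n 0]
    by (simp add: sections_eq image_Un numeral_eq_Suc Un_ac)
  with Suc show ?case by (simp add: rot_pow_image_Suc del: funpow.simps)
qed simp

lemma side_corner_section_disjoint:
  assumes "0 < m" "m < n" "i < 4" "j < 4"
  shows "side_section m n i \<inter> corner_section m n j = {}"
proof -
  have "i \<in> {0, Suc 0, 2, 3}" "j \<in> {0, Suc 0, 2, 3}" using assms by auto
  with assms(1,2) show ?thesis
    by (auto simp: mem_side_section mem_corner_section)
qed

lemma side_sections_disjoint: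
  assumes "0 < m" "m < n" "i < 4" "j < 4" "i \<noteq> j"
  shows "side_section m n i \<inter> side_section m n j = {}"
proof -
  have "i \<in> {0, Suc 0, 2, 3}" "j \<in> {0, Suc 0, 2, 3}" using assms by auto
  with assms(1,2,5) show ?thesis
    by (auto simp: mem_side_section)
qed

lemma corner_sections_disjoint:
  assumes "0 < m" "m < n" "i < 4" "j < 4" "i \<noteq> j"
  shows "corner_section m n i \<inter> corner_section m n j = {}"
proof -
  have "i \<in> {0, Suc 0, 2, 3}" "j \<in> {0, Suc 0, 2, 3}" using assms by auto
  with assms(1,2,5) show ?thesis
    by (auto simp: mem_corner_section)
qed

lemmas sections_disjoint =
  side_corner_section_disjoint side_sections_disjoint corner_sections_disjoint

lemma card_eq_section_counts:
  assumes "0 < m" "m < n" "finite S" "S \<subseteq> sections m n"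
  shows "card S = side_count m n S + corner_count m n S"
proof -
  have "S = (\<Union>j<4. S \<inter> side_section m n j) \<union> (\<Union>j<4. S \<inter> corner_section m n j)"
    using assms(4) by (auto simp: sections_def)
  then have "card S = card \<dots>" by simp
  also have "\<dots> = card (\<Union>j<4. S \<inter> side_section m n j) + card (\<Union>j<4. S \<inter> corner_section m n j)"
    using assms sections_disjoint(1)[of m n] by (intro card_Un_disjoint) auto
  also have "card (\<Union>j<4. S \<inter> side_section m n j) = side_count m n S"
    unfolding side_count_def
    by (intro card_UN_disjoint) (use assms sections_disjoint(2)[of m n] in blast)+
  also have "card (\<Union>j<4. S \<inter> corner_section m n j) = corner_count m n S"
    unfolding corner_count_def
    by (intro card_UN_disjoint) (use assms sections_disjoint(3)[of m n] in blast)+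
  finally show ?thesis .
qed

section \<open>The effect of a lift on the counts\<close>

lemma lift_set_sections:
  assumes "lift_prop t (m, n) = (m', n')"
  shows "lift_set t (m, n) S =
     (\<Union>j<4. (\<lambda>a. a + (rot ^^ j) (shift_E t (m, n))) ` S \<inter> side_section m' n' j) \<union>
     (\<Union>j<4. (\<lambda>a. a + (rot ^^ j) (shift_NE t (m, n))) ` S \<inter> corner_section m' n' j)"
  using assms by (simp add: lift_set_def side_section_def corner_section_def)

text \<open>Up to a rotation, a part of a lift is a translate of the part of \<open>S\<close> in the region
  \<open>X - v\<close>.\<close>

lemma card_shift_Int_rot:
  "card ((\<lambda>a. a + (rot ^^ j) v) ` S \<inter> (rot ^^ j) ` X) = card (S \<inter> (rot ^^ j) ` {b. b + v \<in> X})"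
proof -
  have "(\<lambda>a. a + (rot ^^ j) v) ` S \<inter> (rot ^^ j) ` X =
      (\<lambda>a. a + (rot ^^ j) v) ` (S \<inter> (rot ^^ j) ` {b. b + v \<in> X})"
  proof (intro equalityI subsetI)
    fix z assume "z \<in> (\<lambda>a. a + (rot ^^ j) v) ` S \<inter> (rot ^^ j) ` X"
    then obtain a x where *: "a \<in> S" "x \<in> X" "z = a + (rot ^^ j) v" "z = (rot ^^ j) x"
      by auto
    have "(rot ^^ j) x = (rot ^^ j) (x - v) + (rot ^^ j) v"
      by (simp flip: rot_pow_add)
    with * have "a = (rot ^^ j) (x - v)" by simp
    with * show "z \<in> (\<lambda>a. a + (rot ^^ j) v) ` (S \<inter> (rot ^^ j) ` {b. b + v \<in> X})"
      by auto
  qed (auto simp flip: rot_pow_add)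
  moreover have "inj_on (\<lambda>a. a + (rot ^^ j) v) A" for A
    by (auto simp: inj_on_def)
  ultimately show ?thesis by (simp add: card_image)
qed

lemma card_shift_Int_section:
  assumes "S \<subseteq> sections m n"
    and Y: "sections m n \<inter> {b. b + v \<in> X} = Y"
  shows "card ((\<lambda>a. a + (rot ^^ j) v) ` S \<inter> (rot ^^ j) ` X) = card (S \<inter> (rot ^^ j) ` Y)"
proof -
  have "S = S \<inter> (rot ^^ j) ` sections m n"
    using assms(1) by (auto simp: rot_pow_sections)
  then have "S \<inter> (rot ^^ j) ` {b. b + v \<in> X} = S \<inter> (rot ^^ j) ` (sections m n \<inter> {b. b + v \<in> X})"
    using image_Int[OF inj_rot_pow] by blast
  then show ?thesis using Y by (simp add: card_shift_Int_rot)
qed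

text \<open>The sections of \<open>S\<close> that make up the E and the NE part of its lift.\<close>

lemma lift_f_sources:
  assumes "0 < m" "m < n"
  shows "sections m n \<inter> {b. b + (m + n, 0) \<in> section_E m (2 * m + n)} =
      side_section m n 2 \<union> corner_section m n 1 \<union> corner_section m n 2"
    and "sections m n \<inter> {b. b + (m, m) \<in> section_NE m (2 * m + n)} = corner_section m n 0"
  using assms
  by (auto simp: sections_eq mem_side_section mem_corner_section section_E_def section_NE_def)

lemma lift_g_sources:
  assumes "0 < m" "m < n"
  shows "sections m n \<inter> {b. b + (n - m, 0) \<in> section_E n (2 * n - m)} = side_section m n 0"
    and "sections m n \<inter> {b. b + (n, n) \<in> section_NE n (2 * n - m)} =
      side_section m n 2 \<union> corner_section m n 2 \<union> side_section m n 3"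
  using assms
  by (auto simp: sections_eq mem_side_section mem_corner_section section_E_def section_NE_def)

lemma lift_h_sources:
  assumes "0 < m" "m < n"
  shows "sections m n \<inter> {b. b + (m + n, 0) \<in> section_E n (m + 2 * n)} =
      side_section m n 1 \<union> corner_section m n 1 \<union> side_section m n 2 \<union>
      corner_section m n 2 \<union> side_section m n 3"
    and "sections m n \<inter> {b. b + (n, n) \<in> section_NE n (m + 2 * n)} =
      side_section m n 0 \<union> corner_section m n 0 \<union> side_section m n 1"
  using assms
  by (auto simp: sections_eq mem_side_section mem_corner_section section_E_def section_NE_def)

text \<open>The number of squares of \<open>S\<close> in the four rotated copies of a region.\<close>

definition rot_count :: "square set \<Rightarrow> square set \<Rightarrow> nat" where
  "rot_count S Y = (\<Sum>j<4. card (S \<inter> (rot ^^ j) ` Y))"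

lemma rot_count_Un:
  assumes "finite S" "Y \<inter> Z = {}"
  shows "rot_count S (Y \<union> Z) = rot_count S Y + rot_count S Z"
proof -
  have "card (S \<inter> (rot ^^ j) ` (Y \<union> Z)) = card (S \<inter> (rot ^^ j) ` Y) + card (S \<inter> (rot ^^ j) ` Z)" for j
  proof -
    have "(rot ^^ j) ` Y \<inter> (rot ^^ j) ` Z = {}"
      using assms(2) by (simp flip: image_Int[OF inj_rot_pow])
    with assms(1) show ?thesis
      by (subst card_Un_disjoint [symmetric]) (auto simp: image_Un Int_Un_distrib)
  qed
  then show ?thesis by (simp add: rot_count_def sum.distrib)
qed

lemma rot_count_section:
  assumes "i < 4"
  shows "rot_count S (side_section m n i) = side_count m n S"
    and "rot_count S (corner_section m n i) = corner_count m n S"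
proof -
  have "i \<in> {0, 1, 2, 3}" using assms by auto
  then show "rot_count S (side_section m n i) = side_count m n S"
    and "rot_count S (corner_section m n i) = corner_count m n S"
    using section_add_4[of m n 0] section_add_4[of m n 1] section_add_4[of m n 2]
    by (auto simp: rot_count_def side_count_def corner_count_def rot_pow_section lessThan_4
        numeral_eq_Suc)
qed

lemma side_count_lift_set:
  assumes lift: "lift_prop t (m, n) = (m', n')" "0 < m'" "m' < n'" and S: "S \<subseteq> sections m n"
    and Y: "sections m n \<inter> {b. b + shift_E t (m, n) \<in> section_E m' n'} = Y"
  shows "side_count m' n' (lift_set t (m, n) S) = rot_count S Y"
  unfolding side_count_def rot_count_def
proof (rule sum.cong)
  fix j :: nat assume "j \<in> {..<4}"
  then have "lift_set t (m, n) S \<inter> side_section m' n' j =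
      (\<lambda>a. a + (rot ^^ j) (shift_E t (m, n))) ` S \<inter> side_section m' n' j"
    using side_sections_disjoint[OF lift(2,3), of _ j] side_corner_section_disjoint[OF lift(2,3), of j]
    unfolding lift_set_sections[OF lift(1)] by auto
  then show "card (lift_set t (m, n) S \<inter> side_section m' n' j) = card (S \<inter> (rot ^^ j) ` Y)"
    using card_shift_Int_section[OF S Y] by (simp add: side_section_def)
qed simp

lemma corner_count_lift_set:
  assumes lift: "lift_prop t (m, n) = (m', n')" "0 < m'" "m' < n'" and S: "S \<subseteq> sections m n"
    and Y: "sections m n \<inter> {b. b + shift_NE t (m, n) \<in> section_NE m' n'} = Y"
  shows "corner_count m' n' (lift_set t (m, n) S) = rot_count S Y"
  unfolding corner_count_def rot_count_def
proof (rule sum.cong)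
  fix j :: nat assume "j \<in> {..<4}"
  then have "lift_set t (m, n) S \<inter> corner_section m' n' j =
      (\<lambda>a. a + (rot ^^ j) (shift_NE t (m, n))) ` S \<inter> corner_section m' n' j"
    using corner_sections_disjoint[OF lift(2,3), of _ j] side_corner_section_disjoint[OF lift(2,3), of _ j]
    unfolding lift_set_sections[OF lift(1)] by auto
  then show "card (lift_set t (m, n) S \<inter> corner_section m' n' j) = card (S \<inter> (rot ^^ j) ` Y)"
    using card_shift_Int_section[OF S Y] by (simp add: corner_section_def)
qed simp

text \<open>The pair \<open>((m, n), S)\<close>, as handled by the lifting words, is a finite set of squares in the
  sections of a proper \<open>(m, n)\<close>-frame, with \<open>a\<close> squares in side sections and \<open>b\<close> squares in corner
  sections.\<close>

definition section_counts :: "(int \<times> int) \<times> square set \<Rightarrow> int \<Rightarrow> int \<Rightarrow> bool" where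
  "section_counts = (\<lambda>((m, n), S) a b. 0 < m \<and> m < n \<and> finite S \<and> S \<subseteq> sections m n \<and>
     int (side_count m n S) = a \<and> int (corner_count m n S) = b)"

lemma section_counts_card:
  "section_counts (mn, S) a b \<Longrightarrow> int (card S) = a + b"
  using card_eq_section_counts by (cases mn) (fastforce simp: section_counts_def)

text \<open>The linear action of the lifts on the pair of counts.\<close>

fun lift_counts :: "lifting \<Rightarrow> int \<times> int \<Rightarrow> int \<times> int" where
  "lift_counts Lift_f (a, b) = (a + 2 * b, b)"
| "lift_counts Lift_g (a, b) = (a, 2 * a + b)"
| "lift_counts Lift_h (a, b) = (3 * a + 2 * b, 2 * a + b)"

lemma section_counts_lift:
  assumes "section_counts (mn, S) a b" and "lift_counts t (a, b) = (a', b')"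
  shows "section_counts (lift_prop t mn, lift_set t mn S) a' b'"
proof -
  obtain m n where mn: "mn = (m, n)" by (cases mn)
  have S: "0 < m" "m < n" "finite S" "S \<subseteq> sections m n"
    and ab: "a = int (side_count m n S)" "b = int (corner_count m n S)"
    using assms(1) by (auto simp: section_counts_def mn)
  obtain m' n' where mn': "lift_prop t (m, n) = (m', n')" by fastforce
  have pos: "0 < m'" "m' < n'"
    using mn' S(1,2) by (cases t; auto)+
  have sub: "lift_set t (m, n) S \<subseteq> sections m' n'"
    unfolding lift_set_sections[OF mn'] sections_def by auto
  have fin: "finite (lift_set t (m, n) S)"
    unfolding lift_set_sections[OF mn'] using S(3) by simp
  note disjoint = sections_disjoint[OF S(1,2)]
    side_corner_section_disjoint[OF S(1,2), unfolded Int_commute[of "side_section m n _"]]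
  note counts = side_count_lift_set[OF mn' pos S(4)] corner_count_lift_set[OF mn' pos S(4)]
  have "int (side_count m' n' (lift_set t (m, n) S)) = a' \<and>
      int (corner_count m' n' (lift_set t (m, n) S)) = b'"
  proof (cases t)
    case Lift_f
    then show ?thesis
      using counts mn' assms(2) lift_f_sources[OF S(1,2)] disjoint S(3)
      by (auto simp: ab rot_count_Un rot_count_section Int_Un_distrib2)
  next
    case Lift_g
    then show ?thesis
      using counts mn' assms(2) lift_g_sources[OF S(1,2)] disjoint S(3)
      by (auto simp: ab rot_count_Un rot_count_section Int_Un_distrib2)
  next
    case Lift_h
    then show ?thesis
      using counts mn' assms(2) lift_h_sources[OF S(1,2)] disjoint S(3)
      by (auto simp: ab rot_count_Un rot_count_section Int_Un_distrib2)
  qed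
  with pos sub fin show ?thesis by (simp add: section_counts_def mn mn')
qed

section \<open>Shell cycles\<close>

text \<open>The centers of the eight subboards of the shell, in the order in which a shell cycle visits
  them: E, NW, S, NE, W, SE, N, SW.\<close>

definition shell_centers :: "int \<Rightarrow> int \<Rightarrow> square list" where
  "shell_centers m n =
     [(n - m, 0), (- m, m), (0, m - n), (m, m), (m - n, 0), (m, - m), (0, n - m), (- m, - m)]"

lemma mem_board: "(x, y) \<in> board s \<longleftrightarrow> 2 * x < s \<and> - s < 2 * x \<and> 2 * y < s \<and> - s < 2 * y"
  by (auto simp: board_def)

text \<open>The two kinds of shell have the same centers, and the side of the subboards is the smaller
  of \<open>n - m\<close> and \<open>3m - n\<close>.\<close>

lemma shell_subset:
  assumes "a \<in> shell m n"
  shows "\<exists>k<8. \<exists>u\<in>board (min (n - m) (3 * m - n)). a = shell_centers m n ! k + u"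
proof -
  let ?r = "min (n - m) (3 * m - n)"
  have "\<exists>j x y. a = (rot ^^ j) (x, y) \<and>
      ((x, y) - (n - m, 0) \<in> board ?r \<or> (x, y) - (m, m) \<in> board ?r)"
  proof (cases "n \<le> 2 * m")
    case True
    then obtain j x y where "a = (rot ^^ j) (x, y)"
      and "n - m < 2 * x \<and> 2 * x < 3 * (n - m) \<and> 2 * \<bar>y\<bar> < n - m \<or>
        3 * m - n < 2 * x \<and> 2 * x < m + n \<and> 3 * m - n < 2 * y \<and> 2 * y < m + n"
      using assms unfolding shell_def Let_def by force
    moreover from this(2) True have "(x, y) - (n - m, 0) \<in> board ?r \<or> (x, y) - (m, m) \<in> board ?r"
      by (auto simp: mem_board min_def)
    ultimately show ?thesis by blast
  next
    case False
    then obtain j x y where "a = (rot ^^ j) (x, y)"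
      and "3 * n - 5 * m < 2 * x \<and> 2 * x < m + n \<and> 2 * \<bar>y\<bar> < 3 * m - n \<or>
        n - m < 2 * x \<and> 2 * x < 5 * m - n \<and> n - m < 2 * y \<and> 2 * y < 5 * m - n"
      using assms unfolding shell_def Let_def by force
    moreover from this(2) False have "(x, y) - (n - m, 0) \<in> board ?r \<or> (x, y) - (m, m) \<in> board ?r"
      by (auto simp: mem_board min_def)
    ultimately show ?thesis by blast
  qed
  then obtain j w c where a: "a = (rot ^^ j) (c + w)" and c: "c \<in> {(n - m, 0), (m, m)}"
    and w: "w \<in> board ?r"
    by (metis add_diff_cancel_left' diff_add_cancel add.commute insertCI)
  have "(rot ^^ j) c \<in> set (shell_centers m n)"
  proof (induction j)
    case 0
    then show ?case using c by (auto simp: shell_centers_def)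
  next
    case (Suc j)
    then show ?case by (auto simp: shell_centers_def)
  qed
  moreover have "length (shell_centers m n) = 8" by (simp add: shell_centers_def)
  ultimately obtain k where "k < 8" "(rot ^^ j) c = shell_centers m n ! k"
    by (metis in_set_conv_nth)
  moreover have "(rot ^^ j) w \<in> board ?r"
  proof (induction j)
    case (Suc j)
    then show ?case by (cases "(rot ^^ j) w") (auto simp: mem_board)
  qed (use w in simp)
  ultimately show ?thesis by (auto simp: a rot_pow_add)
qed

text \<open>From a subboard of the shell, two moves keep the offset from the center and lead to the next
  and the previous subboard; each of the other six moves leaves the board.\<close>

lemma shell_adj:
  assumes "0 < m" "k < 8" and u: "u \<in> board (min (n - m) (3 * m - n))"
    and "b \<in> frame m n" and "leaper_adj m n (shell_centers m n ! k + u) b"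
  shows "b = shell_centers m n ! (Suc k mod 8) + u \<or> b = shell_centers m n ! ((k + 7) mod 8) + u"
proof -
  obtain x y where u_eq: "u = (x, y)" by fastforce
  have bounds: "2 * x < n - m" "m - n < 2 * x" "2 * x < 3 * m - n" "n - 3 * m < 2 * x"
    "2 * y < n - m" "m - n < 2 * y" "2 * y < 3 * m - n" "n - 3 * m < 2 * y"
    using u by (auto simp: mem_board u_eq)
  obtain v where v: "v \<in> leaper_moves m n" "b = shell_centers m n ! k + u + v"
    using assms(5) by (auto simp: leaper_adj_def intro: that[of "b - (shell_centers m n ! k + u)"])
  have board: "2 * z < m + n" "- (m + n) < 2 * z" if "z = fst b \<or> z = snd b" for z
    using that assms(4) by (auto simp: frame_def)
  have "k \<in> {0, 1, 2, 3, 4, 5, 6, 7}" using assms(2) by auto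
  then show ?thesis
    using v(1) board[of "fst b"] board[of "snd b"] bounds assms(1)
    unfolding leaper_moves_def v(2) u_eq shell_centers_def
    by (elim insertE emptyE; simp)
qed

lemma leaper_adj_sym:
  assumes "leaper_adj p q a b"
  shows "leaper_adj p q b a"
proof -
  have "- v \<in> leaper_moves p q" if "v \<in> leaper_moves p q" for v
    using that unfolding leaper_moves_def by (elim insertE emptyE) simp_all
  from this[of "b - a"] show ?thesis using assms by (simp add: leaper_adj_def)
qed

text \<open>Every square of a cycle has two distinct neighbors on the cycle.\<close>

lemma leaper_cycle_neighbors:
  assumes "leaper_cycle p q B vs" and "a \<in> set vs"
  obtains b c where "b \<in> set vs" "c \<in> set vs" "b \<noteq> c" "leaper_adj p q a b" "leaper_adj p q a c"
proof -
  let ?n = "length vs"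
  have n: "3 \<le> ?n" and d: "distinct vs"
    and adj: "\<And>j. j < ?n \<Longrightarrow> leaper_adj p q (vs ! j) (vs ! (Suc j mod ?n))"
    using assms(1) by (auto simp: leaper_cycle_def)
  obtain j where j: "j < ?n" "a = vs ! j" using assms(2) by (auto simp: in_set_conv_nth)
  define i where "i = (if j = 0 then ?n - 1 else j - 1)"
  have i: "i < ?n" "Suc i mod ?n = j" using j n by (auto simp: i_def)
  have k: "Suc j mod ?n < ?n" using n by (intro mod_less_divisor) linarith
  have "Suc j mod ?n \<noteq> i"
    using j n by (cases "Suc j = ?n") (auto simp: i_def)
  with d i k have "vs ! (Suc j mod ?n) \<noteq> vs ! i" by (simp add: nth_eq_iff_index_eq)
  with that[of "vs ! (Suc j mod ?n)" "vs ! i"] show thesis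
    using adj[OF j(1)] leaper_adj_sym[OF adj[OF i(1)]] i k j(2) by simp
qed

text \<open>A shell cycle keeps the offset \<open>u\<close> of its first square, because its moves do.  It visits all
  eight subboards, because both possible neighbors of each of its squares belong to it.\<close>

lemma shell_cycle_eq:
  assumes "0 < m" and "shell_cycle m n C"
  obtains u where "u \<in> board (min (n - m) (3 * m - n))"
    and "C = (\<lambda>k. shell_centers m n ! k + u) ` {..<8}"
proof -
  obtain vs where vs: "leaper_cycle m n (frame m n) vs" "set vs = C" "C \<subseteq> shell m n"
    using assms(2) by (auto simp: shell_cycle_def)
  have len: "3 \<le> length vs" and frame: "C \<subseteq> frame m n"
    and adj: "\<And>j. j < length vs \<Longrightarrow> leaper_adj m n (vs ! j) (vs ! (Suc j mod length vs))"
    using vs by (auto simp: leaper_cycle_def)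
  have "vs ! 0 \<in> C" using len unfolding vs(2)[symmetric] by (intro nth_mem) linarith
  with vs(3) obtain k0 u where u: "u \<in> board (min (n - m) (3 * m - n))"
    and k0: "k0 < 8" "vs ! 0 = shell_centers m n ! k0 + u"
    using shell_subset by blast
  define K where "K k = shell_centers m n ! k + u" for k
  have next_K: "b = K (Suc k mod 8) \<or> b = K ((k + 7) mod 8)"
    if "k < 8" "b \<in> C" "leaper_adj m n (K k) b" for k b
    using shell_adj[OF assms(1) that(1) u] that(2,3) frame unfolding K_def by blast
  have "vs ! j \<in> K ` {..<8}" if "j < length vs" for j
    using that
  proof (induction j)
    case 0
    then show ?case using k0 by (auto simp: K_def)
  next
    case (Suc j)
    then obtain k where "k < 8" "vs ! j = K k" by auto
    with adj[of j] next_K[of k "vs ! Suc j"] vs(2) Suc.prems show ?case by auto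
  qed
  then have sub: "C \<subseteq> K ` {..<8}"
    unfolding vs(2)[symmetric] by (metis in_set_conv_nth subsetI)
  have step: "K (Suc k mod 8) \<in> C" if k: "k < 8" "K k \<in> C" for k
  proof -
    obtain b c where "b \<in> C" "c \<in> C" "b \<noteq> c" "leaper_adj m n (K k) b" "leaper_adj m n (K k) c"
      using leaper_cycle_neighbors[OF vs(1), of "K k"] vs(2) k(2) by blast
    with next_K[OF k(1)] show ?thesis by metis
  qed
  have iter: "K ((k0 + i) mod 8) \<in> C" for i
  proof (induction i)
    case 0
    then show ?case using k0 \<open>vs ! 0 \<in> C\<close> by (simp add: K_def)
  next
    case (Suc i)
    then show ?case using step[of "(k0 + i) mod 8"] by (simp add: mod_Suc_eq)
  qed
  have "K k \<in> C" if "k < 8" for k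
  proof -
    have "(k0 + (k + 8 - k0)) mod 8 = k" using k0(1) that by simp
    then show ?thesis using iter by metis
  qed
  with sub have "C = K ` {..<8}" by auto
  with u show thesis by (intro that) (auto simp: K_def)
qed

lemma shell_cycle_section_counts:
  assumes "0 < m" and "shell_cycle m n C"
  shows "section_counts ((m, n), C) 4 4"
proof -
  obtain u where u: "u \<in> board (min (n - m) (3 * m - n))"
    and C: "C = (\<lambda>k. shell_centers m n ! k + u) ` {..<8}"
    using shell_cycle_eq[OF assms] .
  obtain x y where [simp]: "u = (x, y)" by fastforce
  have bounds: "2 * x < n - m" "m - n < 2 * x" "2 * x < 3 * m - n" "n - 3 * m < 2 * x"
    "2 * y < n - m" "m - n < 2 * y" "2 * y < 3 * m - n" "n - 3 * m < 2 * y"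
    using u by (auto simp: mem_board)
  then have "m < n" by linarith
  have "{..<8::nat} = {0, 1, 2, 3, 4, 5, 6, 7}" by auto
  then have C: "C = {(n - m + x, y), (x - m, m + y), (x, m - n + y), (m + x, m + y),
      (m - n + x, y), (m + x, y - m), (x, n - m + y), (x - m, y - m)}"
    by (auto simp: C shell_centers_def)
  \<comment> \<open>Each of the eight squares lies in one section, and so in no other one.\<close>
  have side: "(n - m + x, y) \<in> side_section m n 0" "(x, n - m + y) \<in> side_section m n (Suc 0)"
    "(m - n + x, y) \<in> side_section m n 2" "(x, m - n + y) \<in> side_section m n 3"
    using bounds by (simp_all add: mem_side_section)
  have corner: "(m + x, m + y) \<in> corner_section m n 0" "(x - m, m + y) \<in> corner_section m n (Suc 0)"
    "(x - m, y - m) \<in> corner_section m n 2" "(m + x, y - m) \<in> corner_section m n 3"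
    using bounds by (simp_all add: mem_corner_section)
  note disjoint = sections_disjoint[OF assms(1) \<open>m < n\<close>]
  have side_iff: "z \<in> side_section m n i \<Longrightarrow> i < 4 \<Longrightarrow> j < 4 \<Longrightarrow> z \<in> side_section m n j \<longleftrightarrow> j = i"
    "z \<in> side_section m n i \<Longrightarrow> i < 4 \<Longrightarrow> j < 4 \<Longrightarrow> z \<in> corner_section m n j \<longleftrightarrow> False" for z i j
    using disjoint(1,2)[of i j] by blast+
  have corner_iff: "z \<in> corner_section m n i \<Longrightarrow> i < 4 \<Longrightarrow> j < 4 \<Longrightarrow> z \<in> corner_section m n j \<longleftrightarrow> j = i"
    "z \<in> corner_section m n i \<Longrightarrow> i < 4 \<Longrightarrow> j < 4 \<Longrightarrow> z \<in> side_section m n j \<longleftrightarrow> False" for z i j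
    using disjoint(3)[of i j] disjoint(1)[of j i] by blast+
  note iffs = side[THEN side_iff(1)] side[THEN side_iff(2)]
    corner[THEN corner_iff(1)] corner[THEN corner_iff(2)]
  have "side_count m n C = 4" "corner_count m n C = 4"
    by (simp_all add: side_count_def corner_count_def lessThan_4 C Int_insert_left iffs)
  moreover have "C \<subseteq> sections m n"
    using side corner by (simp add: C sections_eq)
  moreover have "finite C" by (simp add: C)
  ultimately show ?thesis
    using assms(1) \<open>m < n\<close> by (simp add: section_counts_def)
qed

section \<open>Words and continued fractions\<close>

lemma section_counts_lift_word:
  assumes "section_counts st a b" and "foldr lift_counts w (a, b) = (a', b')"
  shows "section_counts (lift_word w st) a' b'"
  using assms(2)
proof (induction w arbitrary: a' b')
  case Nil
  then show ?case using assms(1) by (simp add: lift_word_def)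
next
  case (Cons t w)
  obtain a1 b1 where ab: "foldr lift_counts w (a, b) = (a1, b1)" by fastforce
  obtain mn S where st: "lift_word w st = (mn, S)" by fastforce
  have "section_counts (lift_prop t mn, lift_set t mn S) a' b'"
    using Cons ab st by (intro section_counts_lift) auto
  then show ?case using st by (simp add: lift_word_def)
qed

lemma lift_counts_f_run:
  assumes "even c" "2 \<le> c"
  shows "foldr lift_counts (f_run c) (a, b) = (a + (c - 2) * b, b)"
proof -
  have "foldr lift_counts (replicate k Lift_f) (a, b) = (a + 2 * int k * b, b)" for k
    by (induction k) (auto simp: algebra_simps)
  moreover have "2 * int (nat (c div 2 - 1)) = c - 2" using assms by auto
  ultimately show ?thesis by (simp add: f_run_def)
qed

lemma type_word_Cons:
  "type_word (c # cs) (s # ss) (Suc (Suc i)) = f_run c @ sign_lifting s # type_word cs ss (Suc i)"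
  by (simp add: type_word_def upt_conv_Cons map_Suc_upt[symmetric] o_def del: upt_Suc)

lemma inserted_terms_Cons:
  "inserted_terms (c # cs) (Suc (Suc i)) = c # 2 # inserted_terms cs (Suc i)"
  by (simp add: inserted_terms_def upt_conv_Cons map_Suc_upt[symmetric] o_def del: upt_Suc)

lemma inserted_signs_Cons:
  "inserted_signs (s # ss) (Suc (Suc i)) = s # MinusSign # inserted_signs ss (Suc i)"
  by (simp add: inserted_signs_def upt_conv_Cons map_Suc_upt[symmetric] o_def del: upt_Suc)

text \<open>The bound \<open>d < l\<close> keeps the denominators \<open>l\<close> and \<open>2 - d / l\<close> positive throughout the
  induction, which adds terms at the front.\<close>

lemma lift_counts_type_word:
  assumes "i < length cs" "length cs = length ss + 1" "\<forall>c\<in>set cs. even c \<and> 2 \<le> c"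
  shows "\<exists>l d. 0 < d \<and> d < l \<and> coprime l d \<and>
      of_int l / of_int d = cf_val (inserted_terms cs (Suc i)) (inserted_signs ss (Suc i)) \<and>
      foldr lift_counts (type_word cs ss (Suc i)) (4, 4) = (4 * (l - d), 4 * d)"
  using assms
proof (induction i arbitrary: cs ss)
  case 0
  then obtain c cs' where cs: "cs = c # cs'" "even c" "2 \<le> c" by (cases cs) auto
  then show ?case
    by (intro exI[of _ c] exI[of _ 1])
      (auto simp: inserted_terms_def inserted_signs_def type_word_def lift_counts_f_run)
next
  case (Suc i)
  then obtain c cs' s ss' where cs: "cs = c # cs'" "even c" "2 \<le> c" and ss: "ss = s # ss'"
    by (cases cs; cases ss) auto
  obtain l d where ld: "0 < d" "d < l" "coprime l d"
    and val: "of_int l / of_int d = cf_val (inserted_terms cs' (Suc i)) (inserted_signs ss' (Suc i))"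
    and cnt: "foldr lift_counts (type_word cs' ss' (Suc i)) (4, 4) = (4 * (l - d), 4 * d)"
    using Suc.IH[of cs' ss'] Suc.prems cs ss by auto
  define e :: int where "e = (case s of PlusSign \<Rightarrow> 1 | MinusSign \<Rightarrow> - 1)"
  have e: "of_int e = sign_val s" "e = 1 \<or> e = - 1" by (cases s; simp add: e_def)+
  \<comment> \<open>The new value is \<open>c + e / (2 - d / l)\<close>.\<close>
  define l' d' where "l' = c * (2 * l - d) + e * l" and "d' = 2 * l - d"
  have pos: "0 < d'" "l < d'" using ld by (auto simp: d'_def)
  have "2 * d' \<le> c * d'" using cs pos by (intro mult_right_mono) auto
  with e(2) pos ld have less: "d' < l'" by (auto simp: l'_def d'_def)
  have cop: "coprime l' d'"
  proof (rule coprimeI)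
    fix r assume r: "r dvd l'" "r dvd d'"
    have "r dvd l' - c * d'" using r by auto
    moreover have "l' - c * d' = e * l" by (simp add: l'_def d'_def)
    ultimately have "r dvd l" using e(2) by auto
    moreover have "d = 2 * l - d'" by (simp add: d'_def)
    ultimately have "r dvd d" using r(2) by simp
    with \<open>r dvd l\<close> show "is_unit r" using ld(3) coprime_common_divisor by blast
  qed
  have "(of_int l' :: rat) / of_int d' = of_int c + of_int e * of_int l / of_int d'"
  proof -
    have "l' = c * d' + e * l" by (simp add: l'_def d'_def)
    then show ?thesis using pos by (simp add: field_simps)
  qed
  also have "of_int e * of_int l / of_int d' = of_int e / (2 - (1 :: rat) / (of_int l / of_int d))"
    using pos ld by (simp add: d'_def field_simps)
  finally have "of_int l' / of_int d' =
      cf_val (inserted_terms cs (Suc (Suc i))) (inserted_signs ss (Suc (Suc i)))"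
    by (simp add: cs ss inserted_terms_Cons inserted_signs_Cons val e)
  moreover have "foldr lift_counts (type_word cs ss (Suc (Suc i))) (4, 4) = (4 * (l' - d'), 4 * d')"
    using cs(2,3)
    by (cases s) (simp_all add: cs(1) ss type_word_Cons cnt lift_counts_f_run l'_def d'_def e_def
        algebra_simps)
  ultimately show ?case using pos less cop by (intro exI[of _ l'] exI[of _ d']) auto
qed

lemma cf_val_greater_1:
  assumes "length cs = length ss + 1" "\<forall>c\<in>set cs. 2 \<le> c"
  shows "1 < cf_val cs ss"
  using assms
proof (induction cs ss rule: cf_val.induct)
  case (1 c cs s ss)
  then have "1 < cf_val cs ss" "(2 :: rat) \<le> of_int c" by auto
  moreover from this(1) have "- 1 < sign_val s / cf_val cs ss"
    by (cases s) (auto intro: less_trans[of _ 0])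
  ultimately show ?case unfolding cf_val.simps by linarith
qed auto

text \<open>An even continued fraction may start with 0, but then its value is less than 1.\<close>

lemma even_cf_terms_ge_2:
  assumes "even_cf cs ss" and "1 < cf_val cs ss" and "c \<in> set cs"
  shows "even c \<and> 2 \<le> c"
proof -
  obtain c1 cs' where cs: "cs = c1 # cs'" using assms(1) by (cases cs) (auto simp: even_cf_def)
  have ev: "\<forall>c\<in>set cs. even c" and len: "length cs = length ss + 1"
    using assms(1) by (auto simp: even_cf_def)
  have tail: "\<forall>c\<in>set cs'. 2 \<le> c"
  proof
    fix c assume "c \<in> set cs'"
    then have "0 < c" "even c" using assms(1) ev by (auto simp: even_cf_def cs)
    then show "2 \<le> c" by presburger
  qed
  have "c1 \<noteq> 0"
  proof
    assume "c1 = 0"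
    show False
    proof (cases ss)
      case Nil
      with assms(2) \<open>c1 = 0\<close> show False by (simp add: cs)
    next
      case (Cons s ss')
      then have "1 < cf_val cs' ss'" using len tail by (intro cf_val_greater_1) (auto simp: cs)
      then have "0 < 1 / cf_val cs' ss'" "1 / cf_val cs' ss' < 1" by auto
      with assms(2) \<open>c1 = 0\<close> show False by (cases s) (auto simp: cs Cons)
    qed
  qed
  moreover have "0 \<le> c1" "even c1" using assms(1) by (auto simp: even_cf_def cs)
  ultimately have "2 \<le> c1" by presburger
  with tail ev assms(3) show ?thesis by (auto simp: cs)
qed

lemma irreducible_fraction_unique:
  fixes l d l' d' :: int
  assumes "0 < d" "0 < d'" "coprime l d" "coprime l' d'"
    and "(of_int l :: rat) / of_int d = of_int l' / of_int d'"
  shows "l = l'"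
proof -
  have "(of_int (l * d') :: rat) = of_int (l' * d)"
    using assms by (simp add: field_simps)
  then have "l * d' = l' * d" by (simp only: of_int_eq_iff)
  moreover from this have "d dvd l * d'" "d' dvd l' * d" by (metis dvd_triv_right)+
  then have "d dvd d'" "d' dvd d"
    using assms(3,4) by (simp_all add: coprime_commute coprime_dvd_mult_right_iff)
  then have "d = d'" using assms(1,2) by (simp add: zdvd_antisym_nonneg)
  ultimately show ?thesis using assms(1) by simp
qed

section \<open>The length of a cycle of a given type\<close>

theorem theorem5:
  fixes p q l d :: int and i :: nat
    and cs :: "int list" and ss :: "sign list" and vs :: "square list"
  assumes "0 \<le> p" and "p < q" and "basic_leaper p q" and "skew_leaper p q"
    and "even_cf cs ss" and "of_int q / of_int p = cf_val cs ss"
    and "1 \<le> i" and "i \<le> length cs"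
    and "0 < d" and "coprime l d"
    and "of_int l / of_int d = cf_val (inserted_terms cs i) (inserted_signs ss i)"
    and "cycle_of_type p q cs ss i vs"
  shows "int (length vs) = 4 * l"
proof -
  have "0 < p" using assms(1,4) by (auto simp: skew_leaper_def)
  then have "1 < cf_val cs ss" using assms(2) by (simp flip: assms(6))
  then have terms: "\<forall>c\<in>set cs. even c \<and> 2 \<le> c"
    using even_cf_terms_ge_2 assms(5) by blast
  have len: "length cs = length ss + 1" using assms(5) by (auto simp: even_cf_def)
  obtain i' where i: "i = Suc i'" using assms(7) by (cases i) auto
  obtain l' d' where ld: "0 < d'" "coprime l' d'"
      "of_int l' / of_int d' = cf_val (inserted_terms cs i) (inserted_signs ss i)"
    and cnt: "foldr lift_counts (type_word cs ss i) (4, 4) = (4 * (l' - d'), 4 * d')"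
    using lift_counts_type_word[OF _ len terms, of i'] assms(8) by (auto simp: i)
  have l: "l' = l" using irreducible_fraction_unique ld assms(9-11) by metis
  obtain m n C where frame: "type_frame cs ss i m n" and C: "shell_cycle m n C"
    and vs: "set vs = snd (lift_word (type_word cs ss i) ((m, n), C))" and d: "distinct vs"
    using assms(12) by (auto simp: cycle_of_type_def leaper_cycle_def)
  have "0 < m" using frame by (auto simp: type_frame_def split: if_splits)
  then have "section_counts (lift_word (type_word cs ss i) ((m, n), C)) (4 * (l' - d')) (4 * d')"
    using shell_cycle_section_counts C cnt by (intro section_counts_lift_word) auto
  then have "int (card (set vs)) = 4 * l'"
    using section_counts_card[of "fst (lift_word (type_word cs ss i) ((m, n), C))" "set vs"]
    by (simp add: vs)
  then show ?thesis using d l by (simp add: distinct_card)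
qed

end
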